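(* Let $\Sigma$ be an alphabet, and let $\mathcal{A}$ and $\mathcal{B}$ be two $\Sigma^*$-HDAs. For all homology classes $\alpha\in H_p(\mathcal{A})$ and $\beta\in H_q(\mathcal{B})$, $$\ell_{\mathcal{A}\otimes\mathcal{B}}(\alpha\times\beta)=\ell_{\mathcal{A}}(\alpha)\wedge\ell_{\mathcal{B}}(\beta).$$
   Context: Fix a principal ideal domain $R$; all modules, chain complexes, tensor products of modules and exterior algebras are over $R$. A precubical set is a graded set $P=(P_n)_{n\geq 0}$ with boundary operators $d^k_i\colon P_n\to P_{n-1}$ ($n>0$, $k\in\{0,1\}$, $1\le i\le n$) satisfying $d^k_i\circ d^l_j=d^l_{j-1}\circ d^k_i$ for $k,l\in\{0,1\}$, $i<j$. Elements of $P_n$ have degree $n$. The tensor product $P\otimes Q$ of precubical sets is $(P\otimes Q)_n=\coprod_{p+q=n}P_p\times Q_q$ with $d_i^k(x,y)=(d_i^kx,y)$ for $1\le i\le\deg(x)$ and $d_i^k(x,y)=(x,d^k_{i-\deg(x)}y)$ for $\deg(x)+1\le i\le\deg(x)+\deg(y)$. For a monoid $M$, an $M$-HDA is a tuple $\mathcal{A}=(P_{\mathcal{A}},I_{\mathcal{A}},F_{\mathcal{A}},\lambda_{\mathcal{A}})$ where $P_{\mathcal{A}}$ is a precubical set, $I_{\mathcal{A}},F_{\mathcal{A}}\subseteq (P_{\mathcal{A}})_0$, and $\lambda_{\mathcal{A}}\colon (P_{\mathcal{A}})_1\to M$ satisfies $\lambda_{\mathcal{A}}(d^0_ix)=\lambda_{\mathcal{A}}(d^1_ix)$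 for all $x\in (P_{\mathcal{A}})_2$, $i\in\{1,2\}$. One writes $\mathcal{A}$ for $P_{\mathcal{A}}$. The tensor product $\mathcal{A}\otimes\mathcal{B}$ of $M$-HDAs has precubical set $P_{\mathcal{A}}\otimes P_{\mathcal{B}}$, initial states $I_{\mathcal{A}}\times I_{\mathcal{B}}$, final states $F_{\mathcal{A}}\times F_{\mathcal{B}}$, and labeling function $\lambda(x,v)=\lambda_{\mathcal{A}}(x)$ for $(x,v)\in\mathcal{A}_1\times\mathcal{B}_0$ and $\lambda(v,y)=\lambda_{\mathcal{B}}(y)$ for $(v,y)\in\mathcal{A}_0\times\mathcal{B}_1$. $\Sigma^*$ is the free monoid on the set $\Sigma$; $|m|$ is the length of $m\in\Sigma^*$, and $m=m_1\cdots m_{|m|}$ with $m_j\in\Sigma$. $\Lambda(\Sigma)$ is the exterior algebra on the free module generated by $\Sigma$. For $x\in P_n$, $n>0$, $1\le i\le n$, put $e^0_ix=x$ if $n=1$ and $e^0_ix=d_1^{1}\cdots d_{i-1}^{1}d_{i+1}^{1}\cdots d_n^{1}x\in P_1$ if $n>1$. The cubical chain complex $C_*(P)$ has $C_n(P)$ the free module on $P_n$ and $dx=\sum_{i=1}^n(-1)^i(d^0_ix-d^1_ix)$ for $x\in P_n$; $H_*(P)$ is its homology. The $n$th labeling cochain $\mathfrak{l}^n_{\mathcal{A}}\colon C_*(\mathcal{A})\to\Lambda(\Sigma)$ of a $\Sigma^*$-HDA $\mathcal{A}$ vanishes outside $C_n(\mathcal{A})$ and is given on $x\in\mathcal{A}_n$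 by $\mathfrak{l}^0_{\mathcal{A}}(x)=1$ if $n=0$, and by $\mathfrak{l}^n_{\mathcal{A}}(x)=\sum_{j_1=1}^{|\lambda_{\mathcal{A}}(e^0_1x)|}\cdots\sum_{j_n=1}^{|\lambda_{\mathcal{A}}(e^0_nx)|}\lambda_{\mathcal{A}}(e^0_1x)_{j_1}\wedge\cdots\wedge\lambda_{\mathcal{A}}(e^0_nx)_{j_n}$ if $n>0$. It is a cocycle, and the $n$th labeling homomorphism $\ell_{\mathcal{A}}=\ell^n_{\mathcal{A}}\colon H_n(\mathcal{A})\to\Lambda(\Sigma)$ is defined by $\ell^n_{\mathcal{A}}([z])=\mathfrak{l}^n_{\mathcal{A}}(z)$. The homology cross product $\times\colon H_*(P)\otimes H_*(Q)\to H_*(P\otimes Q)$ is $[a]\times[b]=[\zeta(a\otimes b)]$, where $\zeta\colon C_*(P)\otimes C_*(Q)\to C_*(P\otimes Q)$ is the chain isomorphism given by $x\otimes y\mapsto(x,y)$ for $x\in P$, $y\in Q$. *)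

theory Defs
  imports "HOL-Library.Poly_Mapping" "HOL-Library.FuncSet" "HOL-Algebra.QuotRing"
begin

text \<open>The coefficient ring is a type of the following class.\<close>

class pid = idom +
  assumes principal:
    "\<lbrakk>0 \<in> I; \<And>a b. a \<in> I \<Longrightarrow> b \<in> I \<Longrightarrow> a + b \<in> I; \<And>r a. a \<in> I \<Longrightarrow> r * a \<in> I\<rbrakk>
      \<Longrightarrow> \<exists>g. I = {x. g dvd x}"


section \<open>Precubical sets\<close>

text \<open>
  The components of a graded set are not required to be disjoint, so the boundary operator carries
  the degree of its argument: \<open>bdry P n k i\<close> is the operator from \<open>P\<^sub>n\<close> to \<open>P\<^sub>n\<^sub>-\<^sub>1\<close> with upper index
  \<open>k\<close> and lower index \<open>i\<close>.
\<close>

record 'x precubical =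
  cells :: "nat \<Rightarrow> 'x set"
  bdry :: "nat \<Rightarrow> nat \<Rightarrow> nat \<Rightarrow> 'x \<Rightarrow> 'x"

locale precubical_set =
  fixes P :: "('x, 'z) precubical_scheme"
  assumes bdry_closed:
      "\<lbrakk>n > 0; k \<in> {0, 1}; 1 \<le> i; i \<le> n; x \<in> cells P n\<rbrakk> \<Longrightarrow> bdry P n k i x \<in> cells P (n - 1)"
    and bdry_bdry:
      "\<lbrakk>k \<in> {0, 1}; l \<in> {0, 1}; 1 \<le> i; i < j; j \<le> n; x \<in> cells P n\<rbrakk>
        \<Longrightarrow> bdry P (n - 1) k i (bdry P n l j x) = bdry P (n - 1) l (j - 1) (bdry P n k i x)"

text \<open>
  The coproduct over \<open>p + q = n\<close> is a tagged union: \<open>(p, x, y)\<close> in degree \<open>n\<close> is the pair of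
  \<open>x\<close> of degree \<open>p\<close> and \<open>y\<close> of degree \<open>n - p\<close>.
\<close>

definition precubical_tensor ::
  "('x, 'z) precubical_scheme \<Rightarrow> ('y, 'w) precubical_scheme \<Rightarrow> (nat \<times> 'x \<times> 'y) precubical"
  (infixr \<open>\<otimes>\<^sub>P\<close> 70) where
  "P \<otimes>\<^sub>P Q =
    \<lparr>cells = (\<lambda>n. {(p, x, y). p \<le> n \<and> x \<in> cells P p \<and> y \<in> cells Q (n - p)}),
     bdry = (\<lambda>n k i (p, x, y).
       if i \<le> p then (p - 1, bdry P p k i x, y) else (p, x, bdry Q (n - p) k (i - p) y))\<rparr>"

definition edge0 :: "('x, 'z) precubical_scheme \<Rightarrow> nat \<Rightarrow> nat \<Rightarrow> 'x \<Rightarrow> 'x" where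
  \<comment> \<open>\<open>e\<^sup>0\<^sub>i\<close> on degree \<open>n\<close>: the operators with index \<open>j > i\<close> are applied first, each in degree \<open>j\<close>;
     those with index \<open>j < i\<close> then act in degree \<open>j + 1\<close>\<close>
  "edge0 P n i x =
    foldr (\<lambda>j. bdry P (Suc j) 1 j) [1..<i] (foldr (\<lambda>j. bdry P j 1 j) [Suc i..<Suc n] x)"


section \<open>Higher dimensional automata\<close>

record ('x, 'm) hda = "'x precubical" +
  initial :: "'x set"
  final :: "'x set"
  label :: "'x \<Rightarrow> 'm"

locale M_HDA = monoid M + precubical_set A
  for M :: "('m, 'u) monoid_scheme" and A :: "('x, 'm, 'z) hda_scheme" +
  assumes initial_subset: "initial A \<subseteq> cells A 0"
    and final_subset: "final A \<subseteq> cells A 0"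
    and label_closed: "x \<in> cells A 1 \<Longrightarrow> label A x \<in> carrier M"
    and label_bdry:
      "\<lbrakk>x \<in> cells A 2; i \<in> {1, 2}\<rbrakk> \<Longrightarrow> label A (bdry A 2 0 i x) = label A (bdry A 2 1 i x)"

definition hda_tensor ::
  "('x, 'm) hda \<Rightarrow> ('y, 'm) hda \<Rightarrow> (nat \<times> 'x \<times> 'y, 'm) hda" (infixr \<open>\<otimes>\<^sub>H\<close> 70) where
  "A \<otimes>\<^sub>H B =
    \<lparr>cells = cells (A \<otimes>\<^sub>P B),
     bdry = bdry (A \<otimes>\<^sub>P B),
     initial = {(0, x, y) | x y. x \<in> initial A \<and> y \<in> initial B},
     final = {(0, x, y) | x y. x \<in> final A \<and> y \<in> final B},
     label = (\<lambda>(p, x, y). if p = 1 then label A x else label B y)\<rparr>"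

lemma precubical_set_tensor:
  assumes P: "precubical_set P" and Q: "precubical_set Q"
  shows "precubical_set (P \<otimes>\<^sub>P Q)"
proof
  fix n k i :: nat and w assume *: "n > 0" "k \<in> {0, 1}" "1 \<le> i" "i \<le> n" "w \<in> cells (P \<otimes>\<^sub>P Q) n"
  obtain p x y where w: "w = (p, x, y)" by (cases w)
  show "bdry (P \<otimes>\<^sub>P Q) n k i w \<in> cells (P \<otimes>\<^sub>P Q) (n - 1)"
    using * precubical_set.bdry_closed[OF P, of p k i x]
      precubical_set.bdry_closed[OF Q, of "n - p" k "i - p" y]
    by (auto simp: w precubical_tensor_def diff_right_commute)
next
  fix k l i j n :: nat and w
  assume *: "k \<in> {0, 1}" "l \<in> {0, 1}" "1 \<le> i" "i < j" "j \<le> n" "w \<in> cells (P \<otimes>\<^sub>P Q) n"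
  obtain p x y where w: "w = (p, x, y)" by (cases w)
  consider "j \<le> p" | "i \<le> p" "p < j" | "p < i" by linarith
  then show "bdry (P \<otimes>\<^sub>P Q) (n - 1) k i (bdry (P \<otimes>\<^sub>P Q) n l j w)
    = bdry (P \<otimes>\<^sub>P Q) (n - 1) l (j - 1) (bdry (P \<otimes>\<^sub>P Q) n k i w)"
  proof cases
    case 1
    have "x \<in> cells P p" "i \<le> p - 1" "j - 1 \<le> p - 1" "i \<le> p"
      using 1 * by (auto simp: w precubical_tensor_def)
    with 1 * precubical_set.bdry_bdry[OF P, of k l i j p x] show ?thesis
      by (simp add: w precubical_tensor_def)
  next
    case 2
    with * have "n - 1 - (p - 1) = n - p" "j - 1 - (p - 1) = j - p" by linarith+
    with 2 * show ?thesis by (auto simp: w precubical_tensor_def)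
  next
    case 3
    have "y \<in> cells Q (n - p)" "\<not> j \<le> p" "\<not> j - 1 \<le> p" "j - 1 - p = j - p - 1"
        "n - 1 - p = n - p - 1"
      using 3 * by (auto simp: w precubical_tensor_def)
    with 3 * precubical_set.bdry_bdry[OF Q, of k l "i - p" "j - p" "n - p" y] show ?thesis
      by (simp add: w precubical_tensor_def diff_right_commute)
  qed
qed

lemma M_HDA_tensor:
  assumes A: "M_HDA M A" and B: "M_HDA M B"
  shows "M_HDA M (A \<otimes>\<^sub>H B)"
proof -
  interpret A: M_HDA M A by (rule A)
  interpret B: M_HDA M B by (rule B)
  interpret AB: precubical_set "A \<otimes>\<^sub>P B"
    by (intro precubical_set_tensor A.precubical_set_axioms B.precubical_set_axioms)
  have "precubical_set (A \<otimes>\<^sub>H B)"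
    using AB.precubical_set_axioms by (simp add: precubical_set_def hda_tensor_def)
  moreover have "label (A \<otimes>\<^sub>H B) w \<in> carrier M" if "w \<in> cells (A \<otimes>\<^sub>H B) 1" for w
    using that A.label_closed B.label_closed
    by (auto simp: hda_tensor_def precubical_tensor_def le_Suc_eq)
  moreover have "label (A \<otimes>\<^sub>H B) (bdry (A \<otimes>\<^sub>H B) 2 0 i w) = label (A \<otimes>\<^sub>H B) (bdry (A \<otimes>\<^sub>H B) 2 1 i w)"
    if "w \<in> cells (A \<otimes>\<^sub>H B) 2" "i \<in> {1, 2}" for w i
  proof -
    obtain p x y where w: "w = (p, x, y)" by (cases w)
    from that have "p = 0 \<or> p = 1 \<or> p = 2" by (auto simp: w hda_tensor_def precubical_tensor_def)
    then show ?thesis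
      using that A.label_bdry[of x i] B.label_bdry[of y i]
      by (auto simp: w hda_tensor_def precubical_tensor_def)
  qed
  moreover have "initial (A \<otimes>\<^sub>H B) \<subseteq> cells (A \<otimes>\<^sub>H B) 0" "final (A \<otimes>\<^sub>H B) \<subseteq> cells (A \<otimes>\<^sub>H B) 0"
    using A.initial_subset B.initial_subset A.final_subset B.final_subset
    by (auto simp: hda_tensor_def precubical_tensor_def)
  ultimately show ?thesis
    by (simp add: M_HDA_def M_HDA_axioms_def A.monoid_axioms)
qed

definition free_monoid :: "'a set \<Rightarrow> 'a list monoid" where
  "free_monoid S = \<lparr>carrier = lists S, monoid.mult = (@), one = []\<rparr>"

lemma monoid_free_monoid: "monoid (free_monoid S)"
  by unfold_locales (auto simp: free_monoid_def)


section \<open>Cubical homology and the cross product\<close>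

definition chains :: "('x, 'z) precubical_scheme \<Rightarrow> nat \<Rightarrow> ('x \<Rightarrow>\<^sub>0 'r::comm_ring_1) set" where
  "chains P n = {c. Poly_Mapping.keys c \<subseteq> cells P n}"

definition differential ::
  "('x, 'z) precubical_scheme \<Rightarrow> nat \<Rightarrow> ('x \<Rightarrow>\<^sub>0 'r::comm_ring_1) \<Rightarrow> ('x \<Rightarrow>\<^sub>0 'r)" where
  "differential P n c =
    (\<Sum>x\<in>Poly_Mapping.keys c. \<Sum>i=1..n.
      Poly_Mapping.single (bdry P n 0 i x) (Poly_Mapping.lookup c x * (-1) ^ i)
      - Poly_Mapping.single (bdry P n 1 i x) (Poly_Mapping.lookup c x * (-1) ^ i))"

definition cycles :: "('x, 'z) precubical_scheme \<Rightarrow> nat \<Rightarrow> ('x \<Rightarrow>\<^sub>0 'r::comm_ring_1) set" where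
  "cycles P n = {z \<in> chains P n. differential P n z = 0}"

definition boundaries :: "('x, 'z) precubical_scheme \<Rightarrow> nat \<Rightarrow> ('x \<Rightarrow>\<^sub>0 'r::comm_ring_1) set" where
  "boundaries P n = differential P (Suc n) ` chains P (Suc n)"

definition homologous ::
  "('x, 'z) precubical_scheme \<Rightarrow> nat \<Rightarrow> (('x \<Rightarrow>\<^sub>0 'r::comm_ring_1) \<times> ('x \<Rightarrow>\<^sub>0 'r)) set" where
  "homologous P n = {(z, z'). z \<in> cycles P n \<and> z' \<in> cycles P n \<and> z - z' \<in> boundaries P n}"

definition homology :: "('x, 'z) precubical_scheme \<Rightarrow> nat \<Rightarrow> ('x \<Rightarrow>\<^sub>0 'r::comm_ring_1) set set" where
  "homology P n = cycles P n // homologous P n"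

text \<open>
  The bilinear map \<open>(a, b) \<mapsto> \<zeta>(a \<otimes> b)\<close> for a chain \<open>a\<close> of degree \<open>p\<close>; the degree of \<open>b\<close> is not
  needed.
\<close>

definition cross_chain ::
  "nat \<Rightarrow> ('x \<Rightarrow>\<^sub>0 'r::comm_ring_1) \<Rightarrow> ('y \<Rightarrow>\<^sub>0 'r) \<Rightarrow> (nat \<times> 'x \<times> 'y \<Rightarrow>\<^sub>0 'r)" where
  "cross_chain p a b =
    (\<Sum>x\<in>Poly_Mapping.keys a. \<Sum>y\<in>Poly_Mapping.keys b.
      Poly_Mapping.single (p, x, y) (Poly_Mapping.lookup a x * Poly_Mapping.lookup b y))"

text \<open>
  Here and in the labeling homomorphism below, \<^const>\<open>the_elem\<close> picks the value of an operation that
  is independent of the chosen representatives.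
\<close>

definition cross_product ::
  "('x, 'z) precubical_scheme \<Rightarrow> nat \<Rightarrow> ('y, 'w) precubical_scheme \<Rightarrow> nat
    \<Rightarrow> ('x \<Rightarrow>\<^sub>0 'r::comm_ring_1) set \<Rightarrow> ('y \<Rightarrow>\<^sub>0 'r) set \<Rightarrow> (nat \<times> 'x \<times> 'y \<Rightarrow>\<^sub>0 'r) set" where
  "cross_product P p Q q \<alpha> \<beta> =
    the_elem ((\<lambda>(a, b). homologous (P \<otimes>\<^sub>P Q) (p + q) `` {cross_chain p a b}) ` (\<alpha> \<times> \<beta>))"


section \<open>The exterior algebra on a free module\<close>

text \<open>
  The tensor algebra of the free module on a set \<open>S\<close> is the free associative algebra on \<open>S\<close>, i.e. the
  monoid algebra of the words over \<open>S\<close>. A type of words with concatenation as addition makes the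
  convolution product of \<^theory>\<open>HOL-Library.Poly_Mapping\<close> available for it.
\<close>

datatype 'a word = Word (letters: "'a list")

instantiation word :: (type) monoid_add
begin

definition zero_word :: "'a word" where
  "0 = Word []"

definition plus_word :: "'a word \<Rightarrow> 'a word \<Rightarrow> 'a word" where
  "u + v = Word (letters u @ letters v)"

instance
  by standard (simp_all add: zero_word_def plus_word_def)

end

definition tensor_algebra :: "'a set \<Rightarrow> ('a word \<Rightarrow>\<^sub>0 'r::comm_ring_1) ring" where
  "tensor_algebra S =
    \<lparr>carrier = {t. \<forall>w\<in>Poly_Mapping.keys t. letters w \<in> lists S},
     monoid.mult = (*), one = 1, zero = 0, add = (+)\<rparr>"

lemma ring_tensor_algebra: "ring (tensor_algebra S :: ('a word \<Rightarrow>\<^sub>0 'r::comm_ring_1) ring)"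
proof (rule ringI)
  let ?T = "tensor_algebra S :: ('a word \<Rightarrow>\<^sub>0 'r) ring"
  show "abelian_group ?T"
  proof (rule abelian_groupI)
    fix x y assume "x \<in> carrier ?T" "y \<in> carrier ?T"
    then show "x \<oplus>\<^bsub>?T\<^esub> y \<in> carrier ?T"
      using Poly_Mapping.keys_add[of x y] by (auto simp: tensor_algebra_def)
  next
    fix x assume "x \<in> carrier ?T"
    then show "\<exists>y\<in>carrier ?T. y \<oplus>\<^bsub>?T\<^esub> x = \<zero>\<^bsub>?T\<^esub>"
      by (intro bexI[of _ "- x"]) (auto simp: tensor_algebra_def in_keys_iff)
  qed (auto simp: tensor_algebra_def algebra_simps)
  show "monoid ?T"
  proof (rule monoidI)
    fix x y assume "x \<in> carrier ?T" "y \<in> carrier ?T"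
    then show "x \<otimes>\<^bsub>?T\<^esub> y \<in> carrier ?T"
      using Poly_Mapping.keys_mult[of x y] by (fastforce simp: tensor_algebra_def plus_word_def)
  qed (auto simp: tensor_algebra_def algebra_simps zero_word_def)
qed (auto simp: tensor_algebra_def algebra_simps)

definition free_module_elements :: "'a set \<Rightarrow> ('a word \<Rightarrow>\<^sub>0 'r::comm_ring_1) set" where
  \<comment> \<open>the free module on \<open>S\<close> as the degree one part of its tensor algebra\<close>
  "free_module_elements S = {v. Poly_Mapping.keys v \<subseteq> (\<lambda>s. Word [s]) ` S}"

definition exterior_ideal :: "'a set \<Rightarrow> ('a word \<Rightarrow>\<^sub>0 'r::comm_ring_1) set" where
  "exterior_ideal S = genideal (tensor_algebra S) ((\<lambda>v. v * v) ` free_module_elements S)"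

definition exterior_algebra :: "'a set \<Rightarrow> ('a word \<Rightarrow>\<^sub>0 'r::comm_ring_1) set ring" (\<open>\<Lambda>\<close>) where
  "\<Lambda> S = tensor_algebra S Quot exterior_ideal S"

lemma ideal_exterior_ideal:
  "ideal (exterior_ideal S :: ('a word \<Rightarrow>\<^sub>0 'r::comm_ring_1) set) (tensor_algebra S)"
proof -
  interpret T: ring "tensor_algebra S :: ('a word \<Rightarrow>\<^sub>0 'r) ring"
    by (rule ring_tensor_algebra)
  have "v \<in> carrier (tensor_algebra S)" if "v \<in> free_module_elements S"
    for v :: "'a word \<Rightarrow>\<^sub>0 'r"
    using that by (auto simp: free_module_elements_def tensor_algebra_def)
  then have "v * v \<in> carrier (tensor_algebra S)" if "v \<in> free_module_elements S"
    for v :: "'a word \<Rightarrow>\<^sub>0 'r"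
    using T.m_closed[of v v] that by (simp add: tensor_algebra_def)
  then show ?thesis
    unfolding exterior_ideal_def by (intro T.genideal_ideal) auto
qed

lemma ring_exterior_algebra: "ring (\<Lambda> S :: ('a word \<Rightarrow>\<^sub>0 'r::comm_ring_1) set ring)"
  unfolding exterior_algebra_def by (rule ideal.quotient_is_ring[OF ideal_exterior_ideal])

definition exterior_class ::
  "'a set \<Rightarrow> ('a word \<Rightarrow>\<^sub>0 'r::comm_ring_1) \<Rightarrow> ('a word \<Rightarrow>\<^sub>0 'r) set" where
  "exterior_class S t = exterior_ideal S +>\<^bsub>tensor_algebra S\<^esub> t"

definition exterior_letter :: "'a set \<Rightarrow> 'a \<Rightarrow> ('a word \<Rightarrow>\<^sub>0 'r::comm_ring_1) set" where
  "exterior_letter S s = exterior_class S (Poly_Mapping.single (Word [s]) 1)"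

definition exterior_scale ::
  "'a set \<Rightarrow> 'r::comm_ring_1 \<Rightarrow> ('a word \<Rightarrow>\<^sub>0 'r) set \<Rightarrow> ('a word \<Rightarrow>\<^sub>0 'r) set" where
  "exterior_scale S r X = exterior_class S (Poly_Mapping.single 0 r) \<otimes>\<^bsub>\<Lambda> S\<^esub> X"

abbreviation wedge ::
  "('a word \<Rightarrow>\<^sub>0 'r::comm_ring_1) set \<Rightarrow> 'a set \<Rightarrow> ('a word \<Rightarrow>\<^sub>0 'r) set \<Rightarrow> ('a word \<Rightarrow>\<^sub>0 'r) set"
  (\<open>_ \<and>\<^bsub>_\<^esub> _\<close> [71, 0, 70] 70) where
  "X \<and>\<^bsub>S\<^esub> Y \<equiv> X \<otimes>\<^bsub>\<Lambda> S\<^esub> Y"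


section \<open>Labeling cochains and labeling homomorphisms\<close>

text \<open>
  The iterated sum is a sum over index families \<open>j\<close>, where \<open>j i\<close> ranges over the positions of the
  word \<open>\<lambda>(e\<^sup>0\<^sub>i x)\<close>, counted from \<open>0\<close>. In degree \<open>0\<close> there is exactly one family, contributing the
  empty wedge product, which is the unit.
\<close>

definition labeling_on_cell ::
  "'a set \<Rightarrow> ('x, 'a list, 'z) hda_scheme \<Rightarrow> nat \<Rightarrow> 'x \<Rightarrow> ('a word \<Rightarrow>\<^sub>0 'r::comm_ring_1) set" where
  "labeling_on_cell S A n x =
    (\<Oplus>\<^bsub>\<Lambda> S\<^esub> j \<in> (\<Pi>\<^sub>E i\<in>{1..n}. {..<length (label A (edge0 A n i x))}).
      foldr (\<lambda>i X. exterior_letter S (label A (edge0 A n i x) ! j i) \<and>\<^bsub>S\<^esub> X)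
        [1..<Suc n] \<one>\<^bsub>\<Lambda> S\<^esub>)"

definition labeling_cochain ::
  "'a set \<Rightarrow> ('x, 'a list, 'z) hda_scheme \<Rightarrow> nat
    \<Rightarrow> ('x \<Rightarrow>\<^sub>0 'r::comm_ring_1) \<Rightarrow> ('a word \<Rightarrow>\<^sub>0 'r) set" where
  "labeling_cochain S A n c =
    (\<Oplus>\<^bsub>\<Lambda> S\<^esub> x \<in> Poly_Mapping.keys c.
      exterior_scale S (Poly_Mapping.lookup c x) (labeling_on_cell S A n x))"

definition labeling_hom ::
  "'a set \<Rightarrow> ('x, 'a list, 'z) hda_scheme \<Rightarrow> nat
    \<Rightarrow> ('x \<Rightarrow>\<^sub>0 'r::comm_ring_1) set \<Rightarrow> ('a word \<Rightarrow>\<^sub>0 'r) set" where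
  "labeling_hom S A n \<alpha> = the_elem (labeling_cochain S A n ` \<alpha>)"

end

theory Submission
  imports Defs HOL.Modules
begin

text \<open>
  The label of the \<open>i\<close>-th edge of a cell \<open>(x, y)\<close> of a tensor product is that of the \<open>i\<close>-th edge of \<open>x\<close>
  if \<open>i \<le> deg x\<close>, and that of the \<open>(i - deg x)\<close>-th edge of \<open>y\<close> otherwise. Since the labeling cochain
  of a cell is the product over its edges of the sums of the letters of their labels, it is
  multiplicative already in the tensor algebra, before passing to the exterior algebra. The cocycle
  property also holds there: opposite faces of a cell have the same edge labels, because an edge and
  its translate across the cell are opposite edges of a square. Together with the Leibniz rule for
  the cross product of chains, this makes all values independent of the chosen cycles.
\<close>

section \<open>Additive maps on finitely supported functions\<close>

text \<open>Terms of \<open>a\<close> and \<open>b\<close> may cancel, so the support of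
  \<open>a + b\<close> can be smaller than the union of the two supports. All three sums are taken
  over that union, where an additional key contributes \<open>f x 0 = 0\<close>.\<close>

lemma additive_sum_keys:
  fixes f :: "'x \<Rightarrow> 'r::ab_group_add \<Rightarrow> 'b::ab_group_add"
  assumes "\<And>x. additive (f x)"
  shows "additive (\<lambda>c. \<Sum>x\<in>Poly_Mapping.keys c. f x (Poly_Mapping.lookup c x))"
proof
  fix a b :: "'x \<Rightarrow>\<^sub>0 'r"
  let ?K = "Poly_Mapping.keys a \<union> Poly_Mapping.keys b"
  have eq: "(\<Sum>x\<in>Poly_Mapping.keys c. f x (Poly_Mapping.lookup c x))
      = (\<Sum>x\<in>?K. f x (Poly_Mapping.lookup c x))" if "Poly_Mapping.keys c \<subseteq> ?K" for c
    using that additive.zero[OF assms]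
    by (intro sum.mono_neutral_left) (auto simp: in_keys_iff)
  have "(\<Sum>x\<in>Poly_Mapping.keys (a + b). f x (Poly_Mapping.lookup (a + b) x))
      = (\<Sum>x\<in>?K. f x (Poly_Mapping.lookup a x + Poly_Mapping.lookup b x))"
    by (subst eq[OF Poly_Mapping.keys_add]) (simp only: lookup_add)
  then show "(\<Sum>x\<in>Poly_Mapping.keys (a + b). f x (Poly_Mapping.lookup (a + b) x))
      = (\<Sum>x\<in>Poly_Mapping.keys a. f x (Poly_Mapping.lookup a x))
        + (\<Sum>x\<in>Poly_Mapping.keys b. f x (Poly_Mapping.lookup b x))"
    by (simp only: eq[OF Un_upper1] eq[OF Un_upper2] additive.add[OF assms] sum.distrib)
qed

lemma poly_mapping_eq_sum_single:
  "c = (\<Sum>x\<in>Poly_Mapping.keys c. Poly_Mapping.single x (Poly_Mapping.lookup c x))"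
  by (rule poly_mapping_eqI)
    (auto simp: lookup_sum lookup_single when_def in_keys_iff sum.delta)

text \<open>This replaces extension by linearity from basis elements: a chain is a finite sum of
  \<open>single\<close> terms, and these carry arbitrary coefficients. The restriction to the keys
  of \<open>c\<close> lets the comparison use that they are cells.\<close>

lemma additive_eqI:
  assumes "additive F" and "additive G"
    and "\<And>x r. x \<in> Poly_Mapping.keys c \<Longrightarrow> F (Poly_Mapping.single x r) = G (Poly_Mapping.single x r)"
  shows "F c = G c"
proof -
  have "F c = (\<Sum>x\<in>Poly_Mapping.keys c. F (Poly_Mapping.single x (Poly_Mapping.lookup c x)))"
    by (subst poly_mapping_eq_sum_single[of c]) (rule additive.sum[OF assms(1)])
  also have "\<dots> = (\<Sum>x\<in>Poly_Mapping.keys c. G (Poly_Mapping.single x (Poly_Mapping.lookup c x)))"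
    using assms(3) by (intro sum.cong) auto
  also have "\<dots> = G c"
    \<comment> \<open>The third occurrence of \<open>c\<close> is the argument of \<open>G\<close>
      on the right-hand side.\<close>
    by (subst (3) poly_mapping_eq_sum_single[of c]) (rule additive.sum[OF assms(2), symmetric])
  finally show ?thesis .
qed


section \<open>Cross products of chains\<close>

lemma additive_differential: "additive (differential P n)"
  unfolding differential_def
  by (rule additive_sum_keys)
    (simp add: additive_def distrib_right single_add sum.distrib[symmetric] algebra_simps)

text \<open>The coefficient 0 is a separate case because \<open>single x 0\<close> has empty
  support; both sides are then 0.\<close>

lemma differential_single:
  "differential P n (Poly_Mapping.single x r) =
    (\<Sum>i=1..n. Poly_Mapping.single (bdry P n 0 i x) (r * (-1) ^ i)
      - Poly_Mapping.single (bdry P n 1 i x) (r * (-1) ^ i))"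
  by (cases "r = 0") (simp_all add: differential_def)

lemma additive_cross_chain_left: "additive (\<lambda>a. cross_chain p a b)"
  unfolding cross_chain_def
  by (rule additive_sum_keys)
    (simp add: additive_def distrib_right single_add sum.distrib[symmetric])

text \<open>The two sums are exchanged to bring the sum over the keys of the varying argument
  outside, the form that \<open>additive_sum_keys\<close> handles.\<close>

lemma additive_cross_chain_right: "additive (cross_chain p a)"
proof -
  have "additive (\<lambda>b. \<Sum>y\<in>Poly_Mapping.keys b. \<Sum>x\<in>Poly_Mapping.keys a.
      Poly_Mapping.single (p, x, y) (Poly_Mapping.lookup a x * Poly_Mapping.lookup b y))"
    by (rule additive_sum_keys)
      (simp add: additive_def distrib_left single_add sum.distrib[symmetric])
  then show ?thesis
    unfolding cross_chain_def by (subst sum.swap)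
qed

lemma cross_chain_single:
  "cross_chain p (Poly_Mapping.single x r) (Poly_Mapping.single y s)
    = Poly_Mapping.single (p, x, y) (r * s)"
  by (cases "r = 0"; cases "s = 0") (simp_all add: cross_chain_def)

lemma cross_chain_in_chains:
  assumes "a \<in> chains P p" and "b \<in> chains Q q"
  shows "cross_chain p a b \<in> chains (P \<otimes>\<^sub>P Q) (p + q)"
proof -
  have "Poly_Mapping.keys (cross_chain p a b)
      \<subseteq> (\<Union>x\<in>Poly_Mapping.keys a. \<Union>y\<in>Poly_Mapping.keys b. {(p, x, y)})"
    unfolding cross_chain_def
    by (intro order_trans[OF keys_sum] UN_mono order_refl) auto
  then show ?thesis
    using assms by (fastforce simp: chains_def precubical_tensor_def)
qed

section \<open>The Leibniz rule\<close>

lemma bdry_tensor: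
  "bdry (P \<otimes>\<^sub>P Q) n k i (p, x, y)
    = (if i \<le> p then (p - 1, bdry P p k i x, y) else (p, x, bdry Q (n - p) k (i - p) y))"
  by (simp add: precubical_tensor_def)

text \<open>Both sides are biadditive, so a pair of cells suffices: the faces with index up to
  \<open>p\<close> act on the first factor and the others on the second. The sign (-1)^p appears as
  a case distinction on parity. For \<open>p = 0\<close> the truncated \<open>p - 1\<close> is
  harmless, since the differential in degree 0 is an empty sum.\<close>

lemma differential_cross_chain:
  "differential (P \<otimes>\<^sub>P Q) (p + q) (cross_chain p a b) =
    cross_chain (p - 1) (differential P p a) b
    + (if even p then cross_chain p a (differential Q q b) else - cross_chain p a (differential Q q b))"
    (is "?L a b = ?R a b")
proof -
  note additives = additive_differential additive_cross_chain_left additive_cross_chain_right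
  have L1: "additive (\<lambda>a. ?L a b)" for b
    by (simp add: additive_def additive.add[OF additives(1)] additive.add[OF additives(2)])
  have L2: "additive (?L a)" for a
    by (simp add: additive_def additive.add[OF additives(1)] additive.add[OF additives(3)])
  have R1: "additive (\<lambda>a. ?R a b)" for b
    by (simp add: additive_def additive.add[OF additives(1)] additive.add[OF additives(2)])
  have R2: "additive (?R a)" for a
    by (simp add: additive_def additive.add[OF additives(1)] additive.add[OF additives(3)])
  have single: "?L (Poly_Mapping.single x r) (Poly_Mapping.single y s)
      = ?R (Poly_Mapping.single x r) (Poly_Mapping.single y s)" for x r y s
  proof -
    let ?f = "\<lambda>i. Poly_Mapping.single (bdry (P \<otimes>\<^sub>P Q) (p + q) 0 i (p, x, y)) (r * s * (-1) ^ i)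
      - Poly_Mapping.single (bdry (P \<otimes>\<^sub>P Q) (p + q) 1 i (p, x, y)) (r * s * (-1) ^ i)"
    have "?L (Poly_Mapping.single x r) (Poly_Mapping.single y s) = sum ?f {1..p + q}"
      by (simp add: cross_chain_single differential_single)
    also have "{1..p + q} = {1..p} \<union> {p + 1..p + q}" by auto
    also have "sum ?f \<dots> = sum ?f {1..p} + sum ?f {p + 1..p + q}"
      by (rule sum.union_disjoint) auto
    also have "sum ?f {1..p}
        = cross_chain (p - 1) (differential P p (Poly_Mapping.single x r)) (Poly_Mapping.single y s)"
      by (simp add: differential_single additive.sum[OF additives(2)] additive.diff[OF additives(2)]
          cross_chain_single bdry_tensor mult.assoc mult.commute mult.left_commute)
    also have "sum ?f {p + 1..p + q} = (\<Sum>i=1..q. ?f (p + i))"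
      by (rule sum.reindex_bij_witness[of _ "\<lambda>i. p + i" "\<lambda>i. i - p"]) auto
    \<comment> \<open>The shift of the index by \<open>p\<close> multiplies every sign by (-1)^p,
      which \<open>power_add\<close> splits off.\<close>
    also have "\<dots> = (if even p
        then cross_chain p (Poly_Mapping.single x r) (differential Q q (Poly_Mapping.single y s))
        else - cross_chain p (Poly_Mapping.single x r) (differential Q q (Poly_Mapping.single y s)))"
      by (simp add: differential_single additive.sum[OF additives(3)] additive.diff[OF additives(3)]
          cross_chain_single bdry_tensor power_add mult.assoc single_uminus
          sum_subtractf sum_negf)
    finally show ?thesis .
  qed
  have "?L (Poly_Mapping.single x r) b = ?R (Poly_Mapping.single x r) b" for x r
    using additive_eqI[of "?L (Poly_Mapping.single x r)" "?R (Poly_Mapping.single x r)" b]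
      L2 R2 single by blast
  then show ?thesis
    using additive_eqI[of "\<lambda>a. ?L a b" "\<lambda>a. ?R a b" a] L1 R1 by blast
qed

section \<open>The cross product of homology classes\<close>

lemma
  fixes P :: "('x, 'z) precubical_scheme"
  shows boundaries_0: "(0 :: 'x \<Rightarrow>\<^sub>0 'r::comm_ring_1) \<in> boundaries P n"
    and boundaries_add: "c \<in> boundaries P n \<Longrightarrow> d \<in> boundaries P n \<Longrightarrow> c + d \<in> boundaries P n"
    and boundaries_uminus: "c \<in> boundaries P n \<Longrightarrow> - c \<in> boundaries P n"
proof -
  note D = additive_differential[of P "Suc n"]
  show "(0 :: 'x \<Rightarrow>\<^sub>0 'r) \<in> boundaries P n"
    unfolding boundaries_def
    by (rule image_eqI[of _ _ 0]) (simp_all add: additive.zero[OF D] chains_def)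
  show "- c \<in> boundaries P n" if "c \<in> boundaries P n"
    using that by (auto simp: boundaries_def chains_def additive.minus[OF D, symmetric])
  show "c + d \<in> boundaries P n" if c: "c \<in> boundaries P n" and d: "d \<in> boundaries P n"
  proof -
    obtain c' d' where *: "c = differential P (Suc n) c'" "d = differential P (Suc n) d'"
      "c' \<in> chains P (Suc n)" "d' \<in> chains P (Suc n)"
      using c d unfolding boundaries_def by blast
    then have "c' + d' \<in> chains P (Suc n)"
      using Poly_Mapping.keys_add[of c' d'] by (auto simp: chains_def)
    then show ?thesis
      unfolding boundaries_def by (rule image_eqI[rotated]) (simp add: * additive.add[OF D])
  qed
qed

text \<open>Reflexivity, symmetry and transitivity come from closure of the boundaries under zero,
  negation and addition.\<close>

lemma equiv_homologous: "equiv (cycles P n) (homologous P n)"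
proof (rule equivI)
  show "sym (homologous P n)"
    using boundaries_uminus by (fastforce simp: sym_def homologous_def)
  show "trans (homologous P n)"
  proof (rule transI)
    fix a b c
    assume *: "(a, b) \<in> homologous P n" "(b, c) \<in> homologous P n"
    then have "(a - b) + (b - c) \<in> boundaries P n"
      by (intro boundaries_add) (auto simp: homologous_def)
    with * show "(a, c) \<in> homologous P n"
      by (simp add: homologous_def)
  qed
qed (auto simp: refl_on_def homologous_def boundaries_0)

lemma cross_chain_in_cycles:
  assumes "a \<in> cycles P p" and "b \<in> cycles Q q"
  shows "cross_chain p a b \<in> cycles (P \<otimes>\<^sub>P Q) (p + q)"
  using assms cross_chain_in_chains[of a P p b Q q]
  by (simp add: cycles_def differential_cross_chain additive.zero[OF additive_cross_chain_left]
      additive.zero[OF additive_cross_chain_right])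

text \<open>The cycles are exchanged one at a time. By the Leibniz rule, \<open>a - a'\<close> being
  the boundary of \<open>e\<close> makes the first difference the boundary of the product of
  \<open>e\<close> with \<open>b\<close>; likewise for \<open>b - b'\<close> and \<open>f\<close>
  with \<open>a'\<close> fixed.\<close>

lemma homologous_cross_chain:
  assumes "(a, a') \<in> homologous P p" and "(b, b') \<in> homologous Q q"
  shows "(cross_chain p a b, cross_chain p a' b') \<in> homologous (P \<otimes>\<^sub>P Q) (p + q)"
proof -
  note left = additive_cross_chain_left and right = additive_cross_chain_right
  have cyc: "a \<in> cycles P p" "a' \<in> cycles P p" "b \<in> cycles Q q" "b' \<in> cycles Q q"
    using assms by (auto simp: homologous_def)
  obtain e where e: "e \<in> chains P (Suc p)" "a - a' = differential P (Suc p) e"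
    using assms(1) by (auto simp: homologous_def boundaries_def)
  obtain f where f: "f \<in> chains Q (Suc q)" "b - b' = differential Q (Suc q) f"
    using assms(2) by (auto simp: homologous_def boundaries_def)
  have "cross_chain p a b - cross_chain p a' b = cross_chain p (differential P (Suc p) e) b"
    by (simp add: e(2)[symmetric] additive.diff[OF left])
  also have "\<dots> = differential (P \<otimes>\<^sub>P Q) (Suc (p + q)) (cross_chain (Suc p) e b)"
    using differential_cross_chain[of P Q "Suc p" q e b] cyc(3)
    by (simp add: cycles_def additive.zero[OF right])
  finally have "(cross_chain p a b, cross_chain p a' b) \<in> homologous (P \<otimes>\<^sub>P Q) (p + q)"
    using cyc cross_chain_in_chains[OF e(1), of b Q q]
    by (auto simp: homologous_def boundaries_def cross_chain_in_cycles cycles_def[of Q])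
  moreover have "(cross_chain p a' b, cross_chain p a' b') \<in> homologous (P \<otimes>\<^sub>P Q) (p + q)"
  proof -
    \<comment> \<open>The sign (-1)^p of the Leibniz rule is absorbed into the bounding
      chain.\<close>
    let ?f = "if even p then f else - f"
    have "cross_chain p a' b - cross_chain p a' b' = cross_chain p a' (differential Q (Suc q) f)"
      by (simp add: f(2)[symmetric] additive.diff[OF right])
    also have "\<dots> = differential (P \<otimes>\<^sub>P Q) (Suc (p + q)) (cross_chain p a' ?f)"
      using differential_cross_chain[of P Q p "Suc q" a' ?f] cyc(2)
      by (simp add: cycles_def additive.zero[OF left] additive.minus[OF right]
          additive.minus[OF additive_differential] split: if_splits)
    finally have *: "cross_chain p a' b - cross_chain p a' b'
      = differential (P \<otimes>\<^sub>P Q) (Suc (p + q)) (cross_chain p a' ?f)" .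
    have "?f \<in> chains Q (Suc q)" using f(1) by (simp add: chains_def)
    then have "cross_chain p a' ?f \<in> chains (P \<otimes>\<^sub>P Q) (Suc (p + q))"
      using cross_chain_in_chains[of a' P p ?f Q "Suc q"] cyc(2) by (simp add: cycles_def)
    with * cyc show ?thesis
      by (simp add: homologous_def boundaries_def cross_chain_in_cycles del: if_split)
  qed
  ultimately show ?thesis
    using equiv_homologous[of "P \<otimes>\<^sub>P Q" "p + q"] by (meson equivE transD)
qed

text \<open>All pairs of representatives give the same class by
  \<open>homologous_cross_chain\<close>, so \<open>the_elem\<close> is applied to a
  singleton.\<close>

lemma cross_product_class:
  assumes "a \<in> cycles P p" and "b \<in> cycles Q q"
  shows "cross_product P p Q q (homologous P p `` {a}) (homologous Q q `` {b})
    = homologous (P \<otimes>\<^sub>P Q) (p + q) `` {cross_chain p a b}"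
  unfolding cross_product_def
proof (rule the_elem_image_unique)
  show "homologous P p `` {a} \<times> homologous Q q `` {b} \<noteq> {}"
    using equiv_class_self[OF equiv_homologous assms(1)] equiv_class_self[OF equiv_homologous assms(2)]
    by blast
next
  fix ab assume *: "ab \<in> homologous P p `` {a} \<times> homologous Q q `` {b}"
  obtain a' b' where ab: "ab = (a', b')" by (cases ab)
  show "(case ab of (a, b) \<Rightarrow> homologous (P \<otimes>\<^sub>P Q) (p + q) `` {cross_chain p a b})
    = homologous (P \<otimes>\<^sub>P Q) (p + q) `` {cross_chain p a b}"
    using equiv_class_eq[OF equiv_homologous homologous_cross_chain[of a a' P p b b' Q q]] *
    by (simp add: ab)
qed


section \<open>Labels of edges\<close>

text \<open>The operator applied first has the top index if \<open>i\<close> lies below the degree;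
  if \<open>i\<close> is the degree, as in \<open>edge0_Suc_same\<close>, it has the index just
  below. With \<open>edge0_1\<close> these are the three cases of the inductions that
  follow.\<close>

lemma edge0_Suc: "i \<le> n \<Longrightarrow> edge0 P (Suc n) i x = edge0 P n i (bdry P (Suc n) 1 (Suc n) x)"
  by (simp add: edge0_def)

lemma edge0_Suc_same: "edge0 P (Suc (Suc n)) (Suc (Suc n)) x
    = edge0 P (Suc n) (Suc n) (bdry P (Suc (Suc n)) 1 (Suc n) x)"
  by (simp add: edge0_def)

lemma edge0_1: "edge0 P (Suc 0) (Suc 0) x = x"
  by (simp add: edge0_def)

lemma (in precubical_set) edge0_closed:
  "1 \<le> i \<Longrightarrow> i \<le> n \<Longrightarrow> x \<in> cells P n \<Longrightarrow> edge0 P n i x \<in> cells P 1"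
proof (induction n arbitrary: i x)
  case (Suc n)
  have closed: "bdry P (Suc n) 1 j x \<in> cells P n" if "1 \<le> j" "j \<le> Suc n" for j
    using bdry_closed[of "Suc n" 1 j x] Suc.prems that by simp
  consider "i \<le> n" | "n = 0" "i = 1" | m where "n = Suc m" "i = Suc n"
    using Suc.prems by (cases n) force+
  then show ?case
  proof cases
    case 1
    then show ?thesis
      using Suc.IH[OF _ _ closed[of "Suc n"], of i] Suc.prems by (simp add: edge0_Suc)
  next
    case 2
    then show ?thesis using Suc.prems by (simp add: edge0_1)
  next
    case 3
    then show ?thesis
      using Suc.IH[OF _ _ closed[of n], of n] by (simp add: edge0_Suc_same)
  qed
qed simp

context M_HDA
begin

text \<open>Induction on the degree: the face \<open>i\<close> is moved past the first face taken by
  \<open>edge0\<close>, and the induction hypothesis applies to that face of \<open>x\<close>, a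
  cell of one degree less. The induction bottoms out at a square, where the claim is
  \<open>label_bdry\<close>.\<close>

lemma label_edge0_bdry:
  assumes "1 \<le> j" "j \<le> n" "1 \<le> i" "i \<le> Suc n" "x \<in> cells A (Suc n)"
  shows "label A (edge0 A n j (bdry A (Suc n) 0 i x)) = label A (edge0 A n j (bdry A (Suc n) 1 i x))"
  using assms
proof (induction n arbitrary: i j x)
  case (Suc n)
  have IH: "label A (edge0 A n j (bdry A (Suc n) 0 i (bdry A (Suc (Suc n)) 1 m x)))
      = label A (edge0 A n j (bdry A (Suc n) 1 i (bdry A (Suc (Suc n)) 1 m x)))"
    if "1 \<le> j" "j \<le> n" "1 \<le> i" "i \<le> Suc n" "1 \<le> m" "m \<le> Suc (Suc n)" for i j m
    using Suc.IH[OF that(1-4)] bdry_closed[of "Suc (Suc n)" 1 m x] that Suc.prems by simp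
  \<comment> \<open>The two forms of the precubical identity: for \<open>i \<le> m\<close> the index
    \<open>m\<close> comes from \<open>m + 1\<close>; for \<open>m < i\<close> the index
    \<open>i\<close> drops to \<open>i - 1\<close>.\<close>
  have lower: "bdry A (Suc n) 1 m (bdry A (Suc (Suc n)) k i x)
      = bdry A (Suc n) k i (bdry A (Suc (Suc n)) 1 (Suc m) x)"
    if "k \<in> {0, 1}" "1 \<le> i" "i \<le> m" "m \<le> Suc n" for k i m
    using bdry_bdry[of k 1 i "Suc m" "Suc (Suc n)" x] that Suc.prems by simp
  have upper: "bdry A (Suc n) 1 m (bdry A (Suc (Suc n)) k i x)
      = bdry A (Suc n) k (i - 1) (bdry A (Suc (Suc n)) 1 m x)"
    if "k \<in> {0, 1}" "1 \<le> m" "m < i" "i \<le> Suc (Suc n)" for k i m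
    using bdry_bdry[of 1 k m i "Suc (Suc n)" x] that Suc.prems by simp
  \<comment> \<open>the face \<open>i\<close> commutes past the first face taken by \<open>edge0\<close>, whose index is \<open>m\<close>\<close>
  have step: "label A (edge0 A n j (bdry A (Suc n) 1 m (bdry A (Suc (Suc n)) 0 i x)))
      = label A (edge0 A n j (bdry A (Suc n) 1 m (bdry A (Suc (Suc n)) 1 i x)))"
    if "1 \<le> j" "j \<le> n" "1 \<le> m" "m \<le> Suc n" for j m
  proof (cases "i \<le> m")
    case True
    then show ?thesis
      using IH[of j i "Suc m"] lower[of 0 i m] lower[of 1 i m] that Suc.prems by simp
  next
    case False
    then show ?thesis
      using IH[of j "i - 1" m] upper[of 0 m i] upper[of 1 m i] that Suc.prems by simp
  qed
  consider "j \<le> n" | "n = 0" "j = 1" | m where "n = Suc m" "j = Suc n"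
    using Suc.prems by (cases n) force+
  then show ?case
  proof cases
    case 1
    then show ?thesis
      using step[of j "Suc n"] Suc.prems by (simp add: edge0_Suc)
  next
    case 2
    then show ?thesis
      using label_bdry[of x i] Suc.prems by (auto simp: edge0_1 numeral_2_eq_2 le_Suc_eq)
  next
    case 3
    then show ?thesis
      using step[of n n] by (simp add: edge0_Suc_same)
  qed
qed simp

end

section \<open>Edges of a cell of the tensor product\<close>

text \<open>Induction on \<open>q\<close> removes the directions of \<open>y\<close>, which have the
  highest indices and go first; then induction on \<open>p\<close> treats \<open>x\<close>. The
  vertex \<open>z\<close> left over from \<open>y\<close> stays anonymous because the label ignores
  it.\<close>

lemma edge0_tensor_left:
  assumes "1 \<le> i" "i \<le> p"
  shows "\<exists>z. edge0 (P \<otimes>\<^sub>P Q) (p + q) i (p, x, y) = (1, edge0 P p i x, z)"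
  using assms
proof (induction q arbitrary: y)
  case 0
  then show ?case
  proof (induction p arbitrary: i x)
    case (Suc p)
    consider "i \<le> p" | "p = 0" "i = 1" | m where "p = Suc m" "i = Suc p"
      using Suc.prems by (cases p) force+
    then show ?case
      using Suc.IH Suc.prems(1)
      by cases (simp_all add: edge0_Suc edge0_Suc_same edge0_1 bdry_tensor)
  qed simp
next
  case (Suc q)
  then show ?case
    by (simp add: edge0_Suc bdry_tensor)
qed

lemma edge0_tensor_right:
  assumes "1 \<le> j" "j \<le> q"
  shows "\<exists>z. edge0 (P \<otimes>\<^sub>P Q) (p + q) (p + j) (p, x, y) = (0, z, edge0 Q q j y)"
  using assms
proof (induction q arbitrary: j y)
  case (Suc q)
  consider "j \<le> q" | "q = 0" "j = 1" | m where "q = Suc m" "j = Suc q"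
    using Suc.prems by (cases q) force+
  then show ?case
  proof cases
    case 1
    then show ?thesis
      using Suc.IH Suc.prems(1) by (simp add: edge0_Suc bdry_tensor)
  next
    case 2
    \<comment> \<open>Here \<open>y\<close> is an edge and every face still to be taken lies in
      \<open>x\<close>.\<close>
    show ?thesis unfolding 2
    proof (induction p arbitrary: x)
      case 0
      show ?case by (simp add: edge0_1)
    next
      case (Suc p)
      then show ?case by (simp add: edge0_Suc_same edge0_1 bdry_tensor)
    qed
  next
    case 3
    then show ?thesis
      using Suc.IH[of q] by (simp add: edge0_Suc_same bdry_tensor)
  qed
qed simp


section \<open>Lifting the labeling cochains to the tensor algebra\<close>

definition word_sum :: "'a list \<Rightarrow> ('a word \<Rightarrow>\<^sub>0 'r::comm_ring_1)" where
  "word_sum w = (\<Sum>j<length w. Poly_Mapping.single (Word [w ! j]) 1)"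

text \<open>A product of sums in place of the iterated sum of products. It lives in the tensor
  algebra, where type class arithmetic is available.\<close>

definition label_product ::
  "('x, 'a list, 'z) hda_scheme \<Rightarrow> nat \<Rightarrow> 'x \<Rightarrow> ('a word \<Rightarrow>\<^sub>0 'r::comm_ring_1)" where
  "label_product A n x = prod_list (map (\<lambda>i. word_sum (label A (edge0 A n i x))) [1..<Suc n])"

text \<open>The index 0 of \<open>single\<close> is the empty word, so the left factor is the scalar
  \<open>lookup c x\<close> of the tensor algebra.\<close>

definition labeling_lift ::
  "('x, 'a list, 'z) hda_scheme \<Rightarrow> nat \<Rightarrow> ('x \<Rightarrow>\<^sub>0 'r::comm_ring_1) \<Rightarrow> ('a word \<Rightarrow>\<^sub>0 'r)" where
  "labeling_lift A n c =
    (\<Sum>x\<in>Poly_Mapping.keys c. Poly_Mapping.single 0 (Poly_Mapping.lookup c x) * label_product A n x)"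

lemma additive_labeling_lift: "additive (labeling_lift A n)"
  unfolding labeling_lift_def
  by (rule additive_sum_keys) (simp add: additive_def single_add distrib_right)

lemma labeling_lift_single:
  "labeling_lift A n (Poly_Mapping.single x r) = Poly_Mapping.single 0 r * label_product A n x"
  by (cases "r = 0") (simp_all add: labeling_lift_def)

text \<open>Scalars are central although words do not commute: 0 is neutral on both sides and
  \<open>'r\<close> is commutative.\<close>

lemma single_0_mult_commute:
  fixes t :: "'a::monoid_add \<Rightarrow>\<^sub>0 'r::comm_ring_1"
  shows "t * Poly_Mapping.single 0 r = Poly_Mapping.single 0 r * t"
proof -
  have "additive (\<lambda>t. t * Poly_Mapping.single 0 r)" "additive (\<lambda>t. Poly_Mapping.single 0 r * t)"
    by (simp_all add: additive_def distrib_left distrib_right)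
  then show ?thesis
    using additive_eqI[of "\<lambda>t. t * Poly_Mapping.single 0 r" "\<lambda>t. Poly_Mapping.single 0 r * t" t]
    by (simp add: mult_single mult.commute)
qed

lemma edge0_hda_tensor: "edge0 (A \<otimes>\<^sub>H B) = edge0 (A \<otimes>\<^sub>P B)"
  by (intro ext) (simp add: edge0_def hda_tensor_def)

text \<open>The list of edge indices splits at \<open>p\<close>. The tags 1 and 0 found by the two
  edge lemmas are what \<open>label\<close> of the tensor product dispatches on.\<close>

lemma label_product_tensor:
  "label_product (A \<otimes>\<^sub>H B) (p + q) (p, x, y) = label_product A p x * label_product B q y"
proof -
  let ?f = "\<lambda>i. word_sum (label (A \<otimes>\<^sub>H B) (edge0 (A \<otimes>\<^sub>H B) (p + q) i (p, x, y)))"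
  have "[1..<Suc (p + q)] = [1..<Suc p] @ map (\<lambda>i. i + p) [1..<Suc q]"
    by (induction q) (simp_all add: add.commute)
  then have "label_product (A \<otimes>\<^sub>H B) (p + q) (p, x, y)
      = prod_list (map ?f [1..<Suc p]) * prod_list (map (\<lambda>i. ?f (p + i)) [1..<Suc q])"
    by (simp add: label_product_def comp_def add.commute del: upt_Suc)
  also have "map ?f [1..<Suc p] = map (\<lambda>i. word_sum (label A (edge0 A p i x))) [1..<Suc p]"
  proof (rule map_cong[OF refl])
    fix i assume "i \<in> set [1..<Suc p]"
    then obtain z where "edge0 (A \<otimes>\<^sub>P B) (p + q) i (p, x, y) = (1, edge0 A p i x, z)"
      using edge0_tensor_left[of i p A B q x y] by auto
    then show "?f i = word_sum (label A (edge0 A p i x))"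
      unfolding edge0_hda_tensor by (simp add: hda_tensor_def)
  qed
  also have "map (\<lambda>i. ?f (p + i)) [1..<Suc q]
      = map (\<lambda>i. word_sum (label B (edge0 B q i y))) [1..<Suc q]"
  proof (rule map_cong[OF refl])
    fix i assume "i \<in> set [1..<Suc q]"
    then obtain z where "edge0 (A \<otimes>\<^sub>P B) (p + q) (p + i) (p, x, y) = (0, z, edge0 B q i y)"
      using edge0_tensor_right[of i q A B p x y] by auto
    then show "?f (p + i) = word_sum (label B (edge0 B q i y))"
      unfolding edge0_hda_tensor by (simp add: hda_tensor_def)
  qed
  finally show ?thesis
    by (simp add: label_product_def)
qed

lemma labeling_lift_cross_chain:
  "labeling_lift (A \<otimes>\<^sub>H B) (p + q) (cross_chain p a b) = labeling_lift A p a * labeling_lift B q b"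
  (is "?L a b = ?R a b")
proof -
  note adds = additive.add[OF additive_labeling_lift] additive.add[OF additive_cross_chain_left]
    additive.add[OF additive_cross_chain_right]
  have additives: "additive (\<lambda>a. ?L a b)" "additive (?L a)" "additive (\<lambda>a. ?R a b)" "additive (?R a)" for a b
    by (simp_all add: additive_def adds distrib_left distrib_right)
  have "?L (Poly_Mapping.single x r) (Poly_Mapping.single y s)
      = ?R (Poly_Mapping.single x r) (Poly_Mapping.single y s)" for x r y s
  proof -
    have "?L (Poly_Mapping.single x r) (Poly_Mapping.single y s)
      = Poly_Mapping.single 0 r * (Poly_Mapping.single 0 s * label_product A p x) * label_product B q y"
      by (simp add: cross_chain_single labeling_lift_single label_product_tensor mult_single
          mult.assoc[symmetric])
    \<comment> \<open>The scalar \<open>s\<close> moves past \<open>label_product A p x\<close> to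
      join the second factor.\<close>
    also have "\<dots> = ?R (Poly_Mapping.single x r) (Poly_Mapping.single y s)"
      by (simp add: labeling_lift_single single_0_mult_commute[symmetric, of s] mult.assoc)
    finally show ?thesis .
  qed
  then have "?L (Poly_Mapping.single x r) b = ?R (Poly_Mapping.single x r) b" for x r
    using additive_eqI[of "?L (Poly_Mapping.single x r)" "?R (Poly_Mapping.single x r)" b] additives
    by blast
  then show ?thesis
    using additive_eqI[of "\<lambda>a. ?L a b" "\<lambda>a. ?R a b" a] additives by blast
qed

text \<open>In each direction the two opposite faces have equal label products by
  \<open>label_edge0_bdry\<close> and enter with opposite signs, so they cancel in pairs.\<close>

lemma labeling_lift_differential:
  fixes c :: "'x \<Rightarrow>\<^sub>0 'r::comm_ring_1" and A :: "('x, 'a list, 'z) hda_scheme"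
  assumes "M_HDA M A" and "c \<in> chains A (Suc n)"
  shows "labeling_lift A n (differential A (Suc n) c) = 0"
proof -
  note additives = additive_labeling_lift additive_differential
  have "additive (\<lambda>c. labeling_lift A n (differential A (Suc n) c))" "additive (\<lambda>c. 0)"
    by (simp_all add: additive_def additive.add[OF additives(1)] additive.add[OF additives(2)])
  moreover have "labeling_lift A n (differential A (Suc n) (Poly_Mapping.single x r)) = 0"
    if "x \<in> cells A (Suc n)" for x and r :: 'r
  proof -
    have "label_product A n (bdry A (Suc n) 0 i x)
        = (label_product A n (bdry A (Suc n) 1 i x) :: 'a word \<Rightarrow>\<^sub>0 'r)"
      if "i \<in> {1..Suc n}" for i
      using M_HDA.label_edge0_bdry[OF assms(1), of _ n i x] that \<open>x \<in> _\<close>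
      unfolding label_product_def by (intro arg_cong[of _ _ prod_list] map_cong) auto
    then show ?thesis
      by (auto simp: differential_single additive.sum[OF additives(1)] additive.diff[OF additives(1)]
          labeling_lift_single simp del: sum.cl_ivl_Suc intro!: sum.neutral)
  qed
  ultimately show ?thesis
    using additive_eqI[of "\<lambda>c. labeling_lift A n (differential A (Suc n) c)" "\<lambda>c. 0" c] assms(2)
    by (auto simp: chains_def)
qed


section \<open>Passing to the exterior algebra\<close>

lemma ring_hom_ring_exterior_class:
  "ring_hom_ring (tensor_algebra S) (\<Lambda> S)
    (exterior_class S :: ('a word \<Rightarrow>\<^sub>0 'r::comm_ring_1) \<Rightarrow> _)"
proof -
  have "exterior_class S = (+>\<^bsub>tensor_algebra S\<^esub>) (exterior_ideal S :: ('a word \<Rightarrow>\<^sub>0 'r) set)"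
    by (simp add: exterior_class_def fun_eq_iff)
  then show ?thesis
    using ideal.rcos_ring_hom_ring[OF ideal_exterior_ideal[where ?'r = 'r, of S]]
    by (simp add: exterior_algebra_def)
qed

lemmas exterior_class_hom = ring_hom_ring.homh[OF ring_hom_ring_exterior_class]

section \<open>Membership in the tensor algebra and the rules of the quotient map\<close>

lemma sum_in_tensor_algebra:
  "(\<And>x. x \<in> X \<Longrightarrow> f x \<in> carrier (tensor_algebra S)) \<Longrightarrow> sum f X \<in> carrier (tensor_algebra S)"
  using keys_sum[of f X] by (fastforce simp: tensor_algebra_def)

lemma mult_in_tensor_algebra:
  "t \<in> carrier (tensor_algebra S) \<Longrightarrow> u \<in> carrier (tensor_algebra S)
    \<Longrightarrow> t * u \<in> carrier (tensor_algebra S)"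
  using monoid.m_closed[OF ring.is_monoid[OF ring_tensor_algebra], of t S u]
  by (simp add: tensor_algebra_def)

lemma prod_list_in_tensor_algebra:
  "(\<And>t. t \<in> set ts \<Longrightarrow> t \<in> carrier (tensor_algebra S)) \<Longrightarrow> prod_list ts \<in> carrier (tensor_algebra S)"
proof (induction ts)
  case Nil
  show ?case by (simp add: tensor_algebra_def zero_word_def)
next
  case (Cons t ts)
  then show ?case by (simp add: mult_in_tensor_algebra)
qed

lemma letter_in_tensor_algebra:
  "s \<in> S \<Longrightarrow> Poly_Mapping.single (Word [s]) r \<in> carrier (tensor_algebra S)"
  by (simp add: tensor_algebra_def)

lemma scalar_in_tensor_algebra: "Poly_Mapping.single 0 r \<in> carrier (tensor_algebra S)"
  by (simp add: tensor_algebra_def zero_word_def)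

lemma word_sum_in_tensor_algebra: "w \<in> lists S \<Longrightarrow> word_sum w \<in> carrier (tensor_algebra S)"
  unfolding word_sum_def
  by (intro sum_in_tensor_algebra letter_in_tensor_algebra) (auto simp: lists_eq_set)

lemma exterior_class_mult:
  assumes "t \<in> carrier (tensor_algebra S)" and "u \<in> carrier (tensor_algebra S)"
  shows "exterior_class S (t * u) = exterior_class S t \<and>\<^bsub>S\<^esub> exterior_class S u"
  using ring_hom_mult[OF exterior_class_hom assms] by (simp add: tensor_algebra_def)

lemma exterior_class_add:
  assumes "t \<in> carrier (tensor_algebra S)" and "u \<in> carrier (tensor_algebra S)"
  shows "exterior_class S (t + u) = exterior_class S t \<oplus>\<^bsub>\<Lambda> S\<^esub> exterior_class S u"
  using ring_hom_add[OF exterior_class_hom assms] by (simp add: tensor_algebra_def)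

lemma exterior_class_1: "exterior_class S 1 = \<one>\<^bsub>\<Lambda> S\<^esub>"
  using ring_hom_one[OF exterior_class_hom] by (simp add: tensor_algebra_def)

lemma exterior_class_0: "exterior_class S 0 = \<zero>\<^bsub>\<Lambda> S\<^esub>"
  using ring_hom_zero[OF exterior_class_hom ring_tensor_algebra ring_exterior_algebra]
  by (simp add: tensor_algebra_def)

lemma exterior_class_closed:
  "t \<in> carrier (tensor_algebra S) \<Longrightarrow> exterior_class S t \<in> carrier (\<Lambda> S)"
  by (rule ring_hom_closed[OF exterior_class_hom])

lemma exterior_class_sum:
  fixes f :: "'i \<Rightarrow> 'a word \<Rightarrow>\<^sub>0 'r::comm_ring_1"
  assumes "finite X" and "\<And>x. x \<in> X \<Longrightarrow> f x \<in> carrier (tensor_algebra S)"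
  shows "exterior_class S (sum f X) = (\<Oplus>\<^bsub>\<Lambda> S\<^esub> x\<in>X. exterior_class S (f x))"
proof -
  interpret E: ring "\<Lambda> S :: ('a word \<Rightarrow>\<^sub>0 'r) set ring" by (rule ring_exterior_algebra)
  show ?thesis
    using assms
  proof (induction X)
    case empty
    show ?case by (simp add: exterior_class_0)
  next
    case (insert x X)
    then show ?case
      by (simp add: E.finsum_insert Pi_iff exterior_class_add exterior_class_closed
          sum_in_tensor_algebra)
  qed
qed

text \<open>Distributivity with the factors kept in list order, hence valid without commutativity. A
  choice function on \<open>a # L\<close> is a value at \<open>a\<close> together with a choice
  function on \<open>L\<close>.\<close>

lemma sum_PiE_prod_list:
  fixes g :: "'i \<Rightarrow> 'j \<Rightarrow> 'b::semiring_1"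
  assumes "distinct L"
  shows "(\<Sum>j\<in>Pi\<^sub>E (set L) T. prod_list (map (\<lambda>i. g i (j i)) L))
    = prod_list (map (\<lambda>i. \<Sum>k\<in>T i. g i k) L)"
  using assms
proof (induction L)
  case (Cons a L)
  then have a: "a \<notin> set L" by simp
  have "(\<Sum>j\<in>Pi\<^sub>E (set (a # L)) T. prod_list (map (\<lambda>i. g i (j i)) (a # L)))
      = (\<Sum>(k, j)\<in>T a \<times> Pi\<^sub>E (set L) T. g a k * prod_list (map (\<lambda>i. g i ((j(a := k)) i)) L))"
    unfolding list.set PiE_insert_eq sum.reindex[OF inj_combinator[OF a]]
    by (simp add: comp_def case_prod_unfold)
  \<comment> \<open>As \<open>a\<close> does not occur in \<open>L\<close>, the update at
    \<open>a\<close> leaves the remaining factors unchanged.\<close>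
  also have "\<dots> = (\<Sum>(k, j)\<in>T a \<times> Pi\<^sub>E (set L) T. g a k * prod_list (map (\<lambda>i. g i (j i)) L))"
    using a by (intro sum.cong refl) (auto intro!: arg_cong[of _ _ prod_list] arg_cong2[of _ _ _ _ "(*)"])
  also have "\<dots> = (\<Sum>k\<in>T a. g a k) * (\<Sum>j\<in>Pi\<^sub>E (set L) T. prod_list (map (\<lambda>i. g i (j i)) L))"
    by (simp add: sum_product sum.cartesian_product)
  finally show ?case using Cons by simp
qed simp

lemma exterior_class_letters:
  assumes "\<And>i. i \<in> set L \<Longrightarrow> g i \<in> S"
  shows "exterior_class S (prod_list (map (\<lambda>i. Poly_Mapping.single (Word [g i]) (1::'r::comm_ring_1)) L))
    = foldr (\<lambda>i X. exterior_letter S (g i) \<and>\<^bsub>S\<^esub> X) L \<one>\<^bsub>\<Lambda> S\<^esub>"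
  using assms
proof (induction L)
  case Nil
  show ?case by (simp add: exterior_class_1)
next
  case (Cons i L)
  have "prod_list (map (\<lambda>i. Poly_Mapping.single (Word [g i]) (1::'r)) L) \<in> carrier (tensor_algebra S)"
    by (rule prod_list_in_tensor_algebra) (use Cons.prems in \<open>auto intro: letter_in_tensor_algebra\<close>)
  then show ?case
    using Cons by (simp add: exterior_class_mult letter_in_tensor_algebra exterior_letter_def)
qed

text \<open>The sum over index families is the expansion of the product of word sums. In degree 0
  both sides reduce to the unit.\<close>

lemma labeling_on_cell_eq:
  fixes S :: "'a set" and A :: "('x, 'a list, 'z) hda_scheme"
  assumes "\<And>i. 1 \<le> i \<Longrightarrow> i \<le> n \<Longrightarrow> label A (edge0 A n i x) \<in> lists S"
  shows "labeling_on_cell S A n x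
    = exterior_class S (label_product A n x :: 'a word \<Rightarrow>\<^sub>0 'r::comm_ring_1)"
proof -
  let ?J = "\<Pi>\<^sub>E i\<in>{1..n}. {..<length (label A (edge0 A n i x))}"
  let ?t = "\<lambda>j. prod_list (map (\<lambda>i. Poly_Mapping.single (Word [label A (edge0 A n i x) ! j i]) 1) [1..<Suc n])
    :: 'a word \<Rightarrow>\<^sub>0 'r"
  have S: "label A (edge0 A n i x) ! j i \<in> S" if "j \<in> ?J" "i \<in> set [1..<Suc n]" for i j
    using that assms[of i] nth_mem[of "j i" "label A (edge0 A n i x)"]
    by (auto simp: PiE_iff lists_eq_set simp del: nth_mem)
  have t: "?t j \<in> carrier (tensor_algebra S)" if "j \<in> ?J" for j
    using S[OF that]
    by (auto intro!: prod_list_in_tensor_algebra letter_in_tensor_algebra simp del: upt_Suc)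
  have letters: "foldr (\<lambda>i X. exterior_letter S (label A (edge0 A n i x) ! j i) \<and>\<^bsub>S\<^esub> X)
      [1..<Suc n] \<one>\<^bsub>\<Lambda> S\<^esub> = exterior_class S (?t j)" if "j \<in> ?J" for j
    by (rule exterior_class_letters[symmetric]) (rule S[OF that])
  interpret E: ring "\<Lambda> S :: ('a word \<Rightarrow>\<^sub>0 'r) set ring" by (rule ring_exterior_algebra)
  have "labeling_on_cell S A n x = (\<Oplus>\<^bsub>\<Lambda> S\<^esub> j\<in>?J. exterior_class S (?t j))"
    unfolding labeling_on_cell_def
    by (intro E.finsum_cong' refl funcsetI exterior_class_closed t letters)
  also have "\<dots> = exterior_class S (sum ?t ?J)"
    by (intro exterior_class_sum[symmetric] finite_PiE t) auto
  also have "sum ?t ?J = label_product A n x"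
  proof -
    have "{1..n} = set [1..<Suc n]" by auto
    then show ?thesis
      unfolding label_product_def word_sum_def
      by (simp only: sum_PiE_prod_list[OF distinct_upt,
            where g = "\<lambda>i k. Poly_Mapping.single (Word [label A (edge0 A n i x) ! k]) 1"])
  qed
  finally show ?thesis .
qed

context
  fixes S :: "'a set" and A :: "('x, 'a list, 'z) hda_scheme"
  assumes A: "M_HDA (free_monoid S) A"
begin

interpretation M_HDA "free_monoid S" A by (rule A)

lemma label_edge0_in_lists:
  assumes "x \<in> cells A n" "1 \<le> i" "i \<le> n"
  shows "label A (edge0 A n i x) \<in> lists S"
  using label_closed[OF edge0_closed[OF assms(2,3,1)]] by (simp add: free_monoid_def)

lemma label_product_in_tensor_algebra:
  assumes "x \<in> cells A n"
  shows "label_product A n x \<in> carrier (tensor_algebra S)"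
proof -
  have "word_sum (label A (edge0 A n i x)) \<in> carrier (tensor_algebra S)"
    if "i \<in> set [1..<Suc n]" for i
    using that label_edge0_in_lists[OF assms, of i]
    by (intro word_sum_in_tensor_algebra) (simp add: less_Suc_eq_le del: upt_Suc)
  then show ?thesis
    unfolding label_product_def by (intro prod_list_in_tensor_algebra) auto
qed

lemma scaled_label_product_in_tensor_algebra:
  assumes "x \<in> cells A n"
  shows "Poly_Mapping.single 0 r * label_product A n x \<in> carrier (tensor_algebra S)"
  by (intro mult_in_tensor_algebra scalar_in_tensor_algebra label_product_in_tensor_algebra assms)

lemma labeling_lift_in_tensor_algebra:
  "c \<in> chains A n \<Longrightarrow> labeling_lift A n c \<in> carrier (tensor_algebra S)"
  unfolding labeling_lift_def
  by (intro sum_in_tensor_algebra scaled_label_product_in_tensor_algebra) (auto simp: chains_def)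

lemma labeling_cochain_eq:
  fixes c :: "'x \<Rightarrow>\<^sub>0 'r::comm_ring_1"
  assumes "c \<in> chains A n"
  shows "labeling_cochain S A n c = exterior_class S (labeling_lift A n c)"
proof -
  interpret E: ring "\<Lambda> S :: ('a word \<Rightarrow>\<^sub>0 'r) set ring" by (rule ring_exterior_algebra)
  have cells: "x \<in> cells A n" if "x \<in> Poly_Mapping.keys c" for x
    using assms that by (auto simp: chains_def)
  have "labeling_cochain S A n c = (\<Oplus>\<^bsub>\<Lambda> S\<^esub> x\<in>Poly_Mapping.keys c.
      exterior_class S (Poly_Mapping.single 0 (Poly_Mapping.lookup c x) * label_product A n x))"
    unfolding labeling_cochain_def
    by (intro E.finsum_cong' refl)
      (auto simp: exterior_scale_def labeling_on_cell_eq label_edge0_in_lists cells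
        exterior_class_mult scalar_in_tensor_algebra label_product_in_tensor_algebra
        intro!: exterior_class_closed scaled_label_product_in_tensor_algebra)
  also have "\<dots> = exterior_class S (labeling_lift A n c)"
    unfolding labeling_lift_def
    by (rule exterior_class_sum[symmetric]) (auto intro: scaled_label_product_in_tensor_algebra cells)
  finally show ?thesis .
qed

text \<open>Two representatives differ by a boundary, on which the lift vanishes. The cochain is
  therefore constant on the class.\<close>

lemma labeling_hom_class:
  assumes "z \<in> cycles A n"
  shows "labeling_hom S A n (homologous A n `` {z}) = exterior_class S (labeling_lift A n z)"
  unfolding labeling_hom_def
proof (rule the_elem_image_unique)
  show "homologous A n `` {z} \<noteq> {}"
    using equiv_class_self[OF equiv_homologous assms] by blast
next
  fix z' assume "z' \<in> homologous A n `` {z}"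
  then obtain c where c: "c \<in> chains A (Suc n)" "z - z' = differential A (Suc n) c"
    and z': "z' \<in> chains A n"
    by (auto simp: homologous_def boundaries_def cycles_def)
  have "labeling_lift A n z - labeling_lift A n z' = 0"
    using labeling_lift_differential[OF A c(1)] c(2)
    by (simp add: additive.diff[OF additive_labeling_lift, symmetric])
  with z' show "labeling_cochain S A n z' = exterior_class S (labeling_lift A n z)"
    by (simp add: labeling_cochain_eq)
qed

end

section \<open>Multiplicativity on homology classes\<close>

text \<open>The cross product takes values in the homology of the precubical tensor product, while
  the labeling homomorphism refers to the HDA. The two records differ in type but share cells and
  boundary operators.\<close>

lemma hda_tensor_homology:
  fixes A :: "('x, 'm) hda" and B :: "('y, 'm) hda"
  shows "cycles (A \<otimes>\<^sub>H B) n = (cycles (A \<otimes>\<^sub>P B) n :: (_ \<Rightarrow>\<^sub>0 'r::comm_ring_1) set)"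
    and "homologous (A \<otimes>\<^sub>H B) n = (homologous (A \<otimes>\<^sub>P B) n :: ((_ \<Rightarrow>\<^sub>0 'r) \<times> _) set)"
proof -
  have chains: "chains (A \<otimes>\<^sub>H B) = (chains (A \<otimes>\<^sub>P B) :: _ \<Rightarrow> (_ \<Rightarrow>\<^sub>0 'r) set)"
    by (intro ext) (simp add: chains_def hda_tensor_def)
  have differential: "differential (A \<otimes>\<^sub>H B) = (differential (A \<otimes>\<^sub>P B) :: _ \<Rightarrow> (_ \<Rightarrow>\<^sub>0 'r) \<Rightarrow> _)"
    by (intro ext) (simp add: differential_def hda_tensor_def)
  show cycles: "cycles (A \<otimes>\<^sub>H B) n = (cycles (A \<otimes>\<^sub>P B) n :: (_ \<Rightarrow>\<^sub>0 'r) set)"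
    unfolding cycles_def chains differential ..
  show "homologous (A \<otimes>\<^sub>H B) n = (homologous (A \<otimes>\<^sub>P B) n :: ((_ \<Rightarrow>\<^sub>0 'r) \<times> _) set)"
    unfolding homologous_def cycles boundaries_def chains differential ..
qed

theorem theorem5p3p4:
  fixes \<Sigma> :: "'a set"
    and A :: "('x, 'a list) hda"
    and B :: "('y, 'a list) hda"
    and p q :: nat
    and \<alpha> :: "('x \<Rightarrow>\<^sub>0 'r::pid) set"
    and \<beta> :: "('y \<Rightarrow>\<^sub>0 'r) set"
  assumes "M_HDA (free_monoid \<Sigma>) A"
    and "M_HDA (free_monoid \<Sigma>) B"
    and "\<alpha> \<in> homology A p"
    and "\<beta> \<in> homology B q"
  shows "labeling_hom \<Sigma> (A \<otimes>\<^sub>H B) (p + q) (cross_product A p B q \<alpha> \<beta>)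
       = labeling_hom \<Sigma> A p \<alpha> \<and>\<^bsub>\<Sigma>\<^esub> labeling_hom \<Sigma> B q \<beta>"
proof -
  obtain a where a: "a \<in> cycles A p" "\<alpha> = homologous A p `` {a}"
    using assms(3) unfolding homology_def by (rule quotientE)
  obtain b where b: "b \<in> cycles B q" "\<beta> = homologous B q `` {b}"
    using assms(4) unfolding homology_def by (rule quotientE)
  have "cross_product A p B q \<alpha> \<beta> = homologous (A \<otimes>\<^sub>H B) (p + q) `` {cross_chain p a b}"
    by (simp add: a(2) b(2) cross_product_class[OF a(1) b(1)] hda_tensor_homology)
  then have "labeling_hom \<Sigma> (A \<otimes>\<^sub>H B) (p + q) (cross_product A p B q \<alpha> \<beta>)
      = exterior_class \<Sigma> (labeling_lift A p a * labeling_lift B q b)"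
    using cross_chain_in_cycles[OF a(1) b(1)]
    by (simp add: labeling_hom_class[OF M_HDA_tensor[OF assms(1,2)]] hda_tensor_homology(1)
        labeling_lift_cross_chain)
  \<comment> \<open>Both lifts lie in the carrier of the tensor algebra over \<Sigma>, so the
    quotient map turns their product into the wedge.\<close>
  also have "\<dots> = labeling_hom \<Sigma> A p \<alpha> \<and>\<^bsub>\<Sigma>\<^esub> labeling_hom \<Sigma> B q \<beta>"
    using a b
    by (simp add: exterior_class_mult labeling_lift_in_tensor_algebra[OF assms(1)]
        labeling_lift_in_tensor_algebra[OF assms(2)] labeling_hom_class[OF assms(1)] labeling_hom_class[OF assms(2)]
        cycles_def)
  finally show ?thesis .
qed

end
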